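(* Let $G$ be a connected trivially perfect graph on $m$ edges. Then $\delta(\mathcal{A}(G))\le 2m$.
   Context: All graphs are finite and simple. For a connected graph $G=(V,E)$, a search tree on $G$ is a rooted tree with vertex set $V$ defined recursively: its root is some vertex $r\in V$, and $r$ is joined to the roots of search trees on each connected component of $G-r$. The tubes of a search tree are the vertex sets of its subtrees. Two search trees on $G$ are related by a rotation if their sets of tubes have symmetric difference of size exactly two. The graph associahedron $\mathcal{A}(G)$ is a polytope whose skeleton is isomorphic to the graph on search trees of $G$ with adjacency given by rotations; $\delta(\mathcal{A}(G))$ is the diameter of this graph. A graph is trivially perfect if it can be built recursively from single vertices by (i) adding a new vertex adjacent to all existing vertices and (ii) taking disjoint unions of two trivially perfect graphs. *)

theory Defs
  imports "Graph_Theory.Graph_Theory" "HOL-Library.FSet"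
begin

text \<open>
  A finite simple graph is a \<open>pair_graph\<close>: a finite, symmetric, loop-free digraph whose arcs are
  pairs of vertices. An undirected edge corresponds to two opposite arcs.
\<close>

definition edges :: "'a pair_pre_digraph \<Rightarrow> 'a set set" where
  "edges G = (\<lambda>(u, v). {u, v}) ` parcs G"

inductive trivially_perfect :: "'a pair_pre_digraph \<Rightarrow> bool" where
  single: "trivially_perfect \<lparr>pverts = {v}, parcs = {}\<rparr>"
| dominating: "trivially_perfect \<lparr>pverts = insert v (pverts G),
      parcs = parcs G \<union> {v} \<times> pverts G \<union> pverts G \<times> {v}\<rparr>"
    if "trivially_perfect G" and "v \<notin> pverts G"
| disjoint_union: "trivially_perfect \<lparr>pverts = pverts G \<union> pverts H, parcs = parcs G \<union> parcs H\<rparr>"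
    if "trivially_perfect G" and "trivially_perfect H" and "pverts G \<inter> pverts H = {}"

text \<open>Rooted trees with labelled nodes; the children of a node are not ordered.\<close>

datatype 'a rtree = RNode (rt_root: 'a) (rt_children: "'a rtree fset")

abbreviation rt_verts :: "'a rtree \<Rightarrow> 'a set" where
  "rt_verts \<equiv> set_rtree"

primrec subtrees :: "'a rtree \<Rightarrow> 'a rtree set" where
  "subtrees (RNode r ts) = insert (RNode r ts) (\<Union>(fset (fimage subtrees ts)))"

definition tubes :: "'a rtree \<Rightarrow> 'a set set" where
  "tubes T = rt_verts ` subtrees T"

text \<open>
  For a symmetric digraph the strongly connected components \<open>sccs\<close> (which are induced subgraphs)
  are the connected components. The function \<open>t\<close> selects one search tree on every component of the
  graph without \<open>r\<close>. The definition is meant for connected \<open>G\<close>.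
\<close>

inductive search_tree :: "('a, 'b) pre_digraph \<Rightarrow> 'a rtree \<Rightarrow> bool" where
  "search_tree G (RNode r ts)"
    if "r \<in> verts G"
      and "\<forall>C \<in> pre_digraph.sccs (pre_digraph.del_vert G r). search_tree C (t C)"
      and "fset ts = t ` pre_digraph.sccs (pre_digraph.del_vert G r)"

definition rotation :: "'a rtree \<Rightarrow> 'a rtree \<Rightarrow> bool" where
  "rotation S T \<longleftrightarrow> card ((tubes S - tubes T) \<union> (tubes T - tubes S)) = 2"

text \<open>The skeleton of the graph associahedron of \<open>G\<close>.\<close>

definition rotation_graph :: "('a, 'b) pre_digraph \<Rightarrow> 'a rtree pair_pre_digraph" where
  "rotation_graph G = \<lparr>pverts = {T. search_tree G T},
     parcs = {(S, T). search_tree G S \<and> search_tree G T \<and> rotation S T}\<rparr>"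

text \<open>
  With unit weights, \<open>\<mu>\<close> is the number of arcs on a shortest walk, and \<open>\<infinity>\<close> if there is no walk.
\<close>

definition graph_diameter :: "('a, 'b) pre_digraph \<Rightarrow> ereal" where
  "graph_diameter G = (SUP (u, v) \<in> verts G \<times> verts G. wf_digraph.\<mu> G (\<lambda>_. 1) u v)"

definition associahedron_diameter :: "('a, 'b) pre_digraph \<Rightarrow> ereal" where
  "associahedron_diameter G = graph_diameter (with_proj (rotation_graph G))"

text \<open>
  Since the supremum over an empty set of vertices is \<open>-\<infinity>\<close>, the diameter bound is meaningful only
  because search trees exist; \<open>\<mu>\<close> is meaningful because the rotation graph is well-formed.
\<close>

lemma trivially_perfect_pair_graph: "trivially_perfect G \<Longrightarrow> pair_graph G"
proof (induction rule: trivially_perfect.induct)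
  case (single v)
  show ?case by unfold_locales (auto simp: symmetric_def sym_def)
next
  case (dominating G v)
  interpret pair_graph G by fact
  show ?case
    using pair_finite_verts pair_finite_arcs dominating.hyps(2)
    by unfold_locales (auto simp: symmetric_def sym_def dest: in_arcsD1 in_arcsD2 no_loops' arcs_symmetric)
next
  case (disjoint_union G H)
  interpret G: pair_graph G by fact
  interpret H: pair_graph H by fact
  show ?case
    using G.pair_finite_verts G.pair_finite_arcs H.pair_finite_verts H.pair_finite_arcs
    by unfold_locales
      (auto simp: symmetric_def sym_def
        dest: G.in_arcsD1 G.in_arcsD2 G.no_loops' G.arcs_symmetric
              H.in_arcsD1 H.in_arcsD2 H.no_loops' H.arcs_symmetric)
qed

lemma sccs_del_vert_facts:
  assumes "wf_digraph G"
  shows "wf_digraph (pre_digraph.del_vert G r)"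
    and "C \<in> pre_digraph.sccs (pre_digraph.del_vert G r) \<Longrightarrow> wf_digraph C"
    and "C \<in> pre_digraph.sccs (pre_digraph.del_vert G r) \<Longrightarrow> verts C \<subseteq> verts G - {r}"
    and "C \<in> pre_digraph.sccs (pre_digraph.del_vert G r) \<Longrightarrow> verts C \<noteq> {}"
    and "(\<Union>C \<in> pre_digraph.sccs (pre_digraph.del_vert G r). verts C) = verts G - {r}"
proof -
  interpret wf_digraph G by fact
  show wf: "wf_digraph (pre_digraph.del_vert G r)"
    by (rule wf_digraph_del_vert)
  interpret D: wf_digraph "pre_digraph.del_vert G r" by (rule wf)
  have v: "verts (pre_digraph.del_vert G r) = verts G - {r}"
    by (simp add: pre_digraph.verts_del_vert)
  show "C \<in> D.sccs \<Longrightarrow> wf_digraph C" 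
    by (auto simp: D.sccs_def induced_subgraph_def subgraph_def)
  show *: "C \<in> D.sccs \<Longrightarrow> verts C \<subseteq> verts G - {r}" for C
    using v by (auto simp: D.sccs_def induced_subgraph_def subgraph_def)
  show "C \<in> D.sccs \<Longrightarrow> verts C \<noteq> {}"
    by (auto simp: D.sccs_def strongly_connected_def)
  have "x \<in> (\<Union>C \<in> D.sccs. verts C)" if "x \<in> verts G - {r}" for x
  proof -
    have "D.scc_of x \<in> D.sccs_verts" "x \<in> D.scc_of x"
      using that v unfolding D.sccs_verts_def D.scc_of_def
      by (auto intro: D.reachable_trans)
    thus ?thesis by (auto simp: D.sccs_verts_conv)
  qed
  with * show "(\<Union>C \<in> D.sccs. verts C) = verts G - {r}" by blast
qed

lemma search_tree_verts: "search_tree G T \<Longrightarrow> wf_digraph G \<Longrightarrow> rt_verts T = verts G"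
proof (induction rule: search_tree.induct)
  case (1 r G t ts)
  note wf = \<open>wf_digraph G\<close>
  let ?D = "pre_digraph.sccs (pre_digraph.del_vert G r)"
  have IH: "rt_verts (t C) = verts C" if "C \<in> ?D" for C
    using "1.IH" that sccs_del_vert_facts(2)[OF wf that] by blast
  have "rt_verts (RNode r ts) = insert r (\<Union>C\<in>?D. rt_verts (t C))"
    by (simp add: "1.hyps"(2))
  also have "\<dots> = insert r (\<Union>C\<in>?D. verts C)"
    using IH by simp
  also have "\<dots> = verts G"
    using sccs_del_vert_facts(5)[OF wf, of r] "1.hyps"(1) by auto
  finally show ?case .
qed

lemma search_tree_exists:
  "finite (verts G) \<Longrightarrow> wf_digraph G \<Longrightarrow> verts G \<noteq> {} \<Longrightarrow> \<exists>T. search_tree G T"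
proof (induction "card (verts G)" arbitrary: G rule: less_induct)
  case less
  then obtain r where r: "r \<in> verts G" by auto
  interpret wf_digraph "pre_digraph.del_vert G r" by (rule sccs_del_vert_facts) fact
  have "\<exists>T. search_tree C T" if C: "C \<in> sccs" for C
  proof (rule less.hyps)
    have "verts C \<subset> verts G" using sccs_del_vert_facts(3)[OF less.prems(2) C] r by auto
    thus "card (verts C) < card (verts G)" "finite (verts C)"
      using less.prems by (auto simp: psubset_card_mono intro: finite_subset)
    show "wf_digraph C" by (rule sccs_del_vert_facts(2)[OF less.prems(2) C])
    show "verts C \<noteq> {}" by (rule sccs_del_vert_facts(4)[OF less.prems(2) C])
  qed
  then obtain t where t: "\<And>C. C \<in> sccs \<Longrightarrow> search_tree C (t C)" by metis
  have "inj_on verts sccs"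
  proof (rule inj_onI)
    fix C D assume "C \<in> sccs" "D \<in> sccs" and eq: "verts C = verts D"
    then have "induced_subgraph C (pre_digraph.del_vert G r)" "induced_subgraph D (pre_digraph.del_vert G r)"
      by (simp_all add: sccs_def)
    then have "arcs C = arcs D" "tail C = tail D" "head C = head D"
      unfolding induced_subgraph_def subgraph_def compatible_def by (simp_all add: eq)
    with eq show "C = D" by simp
  qed
  moreover have "finite (verts ` sccs)"
    using sccs_del_vert_facts(3)[OF less.prems(2)] less.prems(1)
    by (intro finite_subset[of "verts ` sccs" "Pow (verts G)"]) auto
  ultimately have "finite sccs" by (rule finite_imageD[rotated])
  hence "fset (Abs_fset (t ` sccs)) = t ` sccs" by (simp add: Abs_fset_inverse)
  with search_tree.intros[OF r] t show ?case by blast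
qed

lemma pair_wf_digraph_rotation_graph: "pair_wf_digraph (rotation_graph G)"
  by unfold_locales (auto simp: rotation_graph_def)

end

theory Submission
  imports Defs
begin

text \<open>
  Every connected induced subgraph of a trivially perfect graph has a universal vertex \<open>u\<close>. In a
  search tree on a vertex set \<open>W\<close>, all proper ancestors of \<open>u\<close> have a single child, since \<open>u\<close> keeps the
  remaining graph connected; hence at most \<open>|W| - 1\<close> rotations bring \<open>u\<close> to the root. Do this in both
  search trees and then transform the subtrees on the components of \<open>W - u\<close> recursively. The two
  initial phases cost at most \<open>2 (|W| - 1)\<close>, twice the number of edges at \<open>u\<close>, and the recursion
  accounts for the edges inside the components.
\<close>

section \<open>Components of vertex subsets via cuts\<close>

text \<open>
  Connectivity is expressed by cuts, which turns all facts about components of subsets into set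
  algebra; \<open>sccs_verts_symmetric\<close> translates to reachability.
\<close>

definition cut_connected :: "('a \<times> 'a) set \<Rightarrow> 'a set \<Rightarrow> bool" where
  "cut_connected E C \<longleftrightarrow> C \<noteq> {} \<and> (\<forall>A \<subseteq> C. A \<noteq> {} \<longrightarrow> E \<inter> A \<times> (C - A) = {} \<longrightarrow> A = C)"

definition comps :: "('a \<times> 'a) set \<Rightarrow> 'a set \<Rightarrow> 'a set set" where
  "comps E W = {C. C \<subseteq> W \<and> cut_connected E C \<and> E \<inter> C \<times> (W - C) = {}}"

lemma cut_connectedD:
  "cut_connected E C \<Longrightarrow> A \<subseteq> C \<Longrightarrow> A \<noteq> {} \<Longrightarrow> E \<inter> A \<times> (C - A) = {} \<Longrightarrow> A = C"
  by (auto simp: cut_connected_def)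

text \<open>An arc from \<open>C \<inter> D\<close> into \<open>C - D\<close> would leave
  \<open>D\<close> inside \<open>W\<close>, and symmetrically for \<open>D - C\<close>. So the
  nonempty intersection is closed in both sets, and cut-connectedness makes it equal to
  each.\<close>

lemma comps_disjoint:
  assumes "C \<in> comps E W" "D \<in> comps E W" "C \<inter> D \<noteq> {}"
  shows "C = D"
proof -
  have "C \<inter> D = C"
    using assms by (intro cut_connectedD[of E C]) (auto simp: comps_def)
  moreover have "C \<inter> D = D"
    using assms by (intro cut_connectedD[of E D]) (auto simp: comps_def)
  ultimately show ?thesis by simp
qed

lemma comps_cut_connected:
  assumes "cut_connected E W"
  shows "comps E W = {W}"
proof -
  have "C = W" if "C \<in> comps E W" for C
    using that assms by (intro cut_connectedD[of E W]) (auto simp: comps_def cut_connected_def)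
  moreover have "W \<in> comps E W"
    using assms by (auto simp: comps_def)
  ultimately show ?thesis by blast
qed

text \<open>The part of a component inside \<open>X\<close> has no arc to its part inside
  \<open>Y\<close>, so a component that meets \<open>X\<close> lies in \<open>X\<close>.\<close>

lemma in_comps_Un:
  assumes "E \<inter> X \<times> Y = {}" "E \<inter> Y \<times> X = {}" "X \<inter> Y = {}" "C \<in> comps E (X \<union> Y)"
  shows "C \<in> comps E X \<union> comps E Y"
proof -
  have C: "C \<subseteq> X \<union> Y" "cut_connected E C" "E \<inter> C \<times> (X \<union> Y - C) = {}"
    using assms(4) by (auto simp: comps_def)
  have "C \<subseteq> X" if "C \<inter> X \<noteq> {}"
  proof -
    have "C \<inter> X = C"
      using C assms that by (intro cut_connectedD[OF C(2)]) auto
    thus ?thesis by blast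
  qed
  hence "C \<subseteq> X \<or> C \<subseteq> Y" using C(1) by blast
  thus ?thesis using C by (auto simp: comps_def)
qed

lemma comps_Un:
  assumes "E \<inter> X \<times> Y = {}" "E \<inter> Y \<times> X = {}" "X \<inter> Y = {}"
  shows "comps E (X \<union> Y) = comps E X \<union> comps E Y"
proof
  show "comps E (X \<union> Y) \<subseteq> comps E X \<union> comps E Y"
    using in_comps_Un[OF assms] by blast
  have "C \<in> comps E (X \<union> Y)" if "C \<in> comps E X" for C
  proof -
    have "E \<inter> C \<times> (X \<union> Y - C) = {}" using that assms(1) unfolding comps_def by fast
    thus ?thesis using that by (auto simp: comps_def)
  qed
  moreover have "C \<in> comps E (X \<union> Y)" if "C \<in> comps E Y" for C
  proof -
    have "E \<inter> C \<times> (X \<union> Y - C) = {}" using that assms(2) unfolding comps_def by fast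
    thus ?thesis using that by (auto simp: comps_def)
  qed
  ultimately show "comps E X \<union> comps E Y \<subseteq> comps E (X \<union> Y)" by blast
qed

text \<open>No arc joins \<open>A\<close> to \<open>W - A\<close>, so \<open>W\<close> and
  \<open>W - {r}\<close> both split along \<open>A\<close>, and deleting \<open>r\<close> only
  affects the half inside \<open>A\<close>. This is why a rotation keeps all but one tube.\<close>

lemma comps_Diff_singleton:
  assumes "sym E" "A \<in> comps E W" "r \<in> A"
  shows "comps E (W - {r}) = (comps E W - {A}) \<union> comps E (A - {r})"
proof -
  have A: "A \<subseteq> W" "cut_connected E A" "E \<inter> A \<times> (W - A) = {}"
    using assms(2) by (auto simp: comps_def)
  hence A': "E \<inter> (W - A) \<times> A = {}" using assms(1) by (auto dest: symD)
  have W: "W = A \<union> (W - A)" and Wr: "W - {r} = (A - {r}) \<union> (W - A)"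
    using A assms(3) by auto
  have "comps E W = comps E A \<union> comps E (W - A)"
    by (subst W, rule comps_Un) (use A A' in auto)
  moreover have "A \<notin> comps E (W - A)" using assms(3) by (auto simp: comps_def)
  ultimately have "comps E W - {A} = comps E (W - A)"
    using comps_cut_connected[OF A(2)] by auto
  moreover have "comps E (W - {r}) = comps E (A - {r}) \<union> comps E (W - A)"
    by (subst Wr, rule comps_Un) (use A A' in auto)
  ultimately show ?thesis by auto
qed

lemma cut_connected_restrict:
  assumes "C \<subseteq> W"
  shows "cut_connected (E \<inter> W \<times> W) C \<longleftrightarrow> cut_connected E C"
proof -
  have "E \<inter> W \<times> W \<inter> A \<times> (C - A) = E \<inter> A \<times> (C - A)" if "A \<subseteq> C" for A
    using assms that by fast
  thus ?thesis unfolding cut_connected_def by (simp cong: imp_cong)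
qed

lemma cut_connected_cong:
  "E \<inter> C \<times> C = F \<inter> C \<times> C \<Longrightarrow> cut_connected E C \<longleftrightarrow> cut_connected F C"
  by (metis cut_connected_restrict order_refl)

lemma comps_restrict: "comps (E \<inter> W \<times> W) W = comps E W"
proof -
  have "E \<inter> W \<times> W \<inter> C \<times> (W - C) = E \<inter> C \<times> (W - C)" if "C \<subseteq> W" for C
    using that by fast
  thus ?thesis unfolding comps_def by (auto simp: cut_connected_restrict)
qed

text \<open>A closed nonempty \<open>A\<close> contains \<open>u\<close>, since otherwise the arc
  from any of its elements to \<open>u\<close> would leave it; from \<open>u\<close> the arcs lead
  everywhere.\<close>

lemma cut_connected_universal:
  assumes "sym E" "u \<in> W" "\<And>x. x \<in> W \<Longrightarrow> x \<noteq> u \<Longrightarrow> (u, x) \<in> E"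
  shows "cut_connected E W"
  unfolding cut_connected_def
proof (intro conjI allI impI)
  fix A assume A: "A \<subseteq> W" "A \<noteq> {}" "E \<inter> A \<times> (W - A) = {}"
  obtain a where a: "a \<in> A" using A by blast
  have "u \<in> A"
  proof (rule ccontr)
    assume "u \<notin> A"
    hence "(u, a) \<in> E" using a A assms by blast
    thus False using \<open>u \<notin> A\<close> a A assms(1,2) by (blast dest: symD)
  qed
  thus "A = W" using A assms(3) by blast
qed (use assms in blast)

section \<open>Tubes, and trees built from a root and a family of children\<close>

lemma tubes_RNode: "tubes (RNode r ts) = insert (rt_verts (RNode r ts)) (\<Union>T \<in> fset ts. tubes T)"
  by (auto simp: tubes_def)

text \<open>Nonemptiness matters: it is what makes subtrees on disjoint vertex sets have no tube in
  common.\<close>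

lemma tubes_subset: "A \<in> tubes T \<Longrightarrow> A \<noteq> {} \<and> A \<subseteq> rt_verts T"
proof (induction T arbitrary: A)
  case (RNode r ts)
  show ?case using RNode.prems unfolding tubes_RNode
  proof (elim insertE UN_E)
    fix T assume T: "T \<in> fset ts" "A \<in> tubes T"
    show ?thesis using RNode.IH[OF T] T by auto
  qed auto
qed

text \<open>\<open>K\<close> has to be finite: \<open>Abs_fset\<close> is unspecified on infinite sets.\<close>

definition node :: "'a \<Rightarrow> 'a set set \<Rightarrow> ('a set \<Rightarrow> 'a rtree) \<Rightarrow> 'a rtree" where
  "node r K t = RNode r (Abs_fset (t ` K))"

lemma rt_root_node[simp]: "rt_root (node r K t) = r"
  by (simp add: node_def)

lemma node_cong: "r = r' \<Longrightarrow> K = K' \<Longrightarrow> (\<And>C. C \<in> K' \<Longrightarrow> t C = t' C) \<Longrightarrow> node r K t = node r' K' t'"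
  by (simp add: node_def cong: image_cong)

lemma tubes_node:
  "finite K \<Longrightarrow> tubes (node r K t) = insert (rt_verts (node r K t)) (\<Union>C \<in> K. tubes (t C))"
  unfolding node_def by (simp add: tubes_RNode Abs_fset_inverse)

lemma rotation_commute: "rotation S T \<longleftrightarrow> rotation T S"
  by (simp add: rotation_def Un_commute)

section \<open>Strong components of symmetric digraphs\<close>

lemma sccs_verts_symmetric:
  assumes "sym_digraph H"
  shows "pre_digraph.sccs_verts H = comps (arcs_ends H) (verts H)"
proof -
  interpret sym_digraph H by fact
  \<comment> \<open>A set without outgoing arcs is closed under reachability.\<close>
  have step: "v \<in> A" if "u \<rightarrow>\<^sup>*\<^bsub>H\<^esub> v" "u \<in> A" "arcs_ends H \<inter> A \<times> (verts H - A) = {}" for u v A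
    using that by (induction rule: reachable_induct) (auto dest: adj_in_verts)
  show ?thesis
  proof (intro set_eqI iffI)
    fix C assume C: "C \<in> sccs_verts"
    have r: "\<forall>u\<in>C. \<forall>v\<in>C. u \<rightarrow>\<^sup>*\<^bsub>H\<^esub> v" "C \<noteq> {}" 
      "\<forall>u \<in> C. \<forall>v. v \<notin> C \<longrightarrow> \<not>u \<rightarrow>\<^sup>*\<^bsub>H\<^esub> v \<or> \<not>v \<rightarrow>\<^sup>*\<^bsub>H\<^esub> u"
      using C by (auto simp: sccs_verts_def)
    have sub: "C \<subseteq> verts H" using C by (rule sccs_verts_subsets)
    \<comment> \<open>By symmetry a single arc out of \<open>C\<close> would already make its head
      mutually reachable with its tail.\<close>
    have closed: "arcs_ends H \<inter> C \<times> (verts H - C) = {}"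
      using r(3) symmetric_reachable' reachable_adjI by blast
    have "A = C" if A: "A \<subseteq> C" "A \<noteq> {}" "arcs_ends H \<inter> A \<times> (C - A) = {}" for A
    proof -
      have "arcs_ends H \<inter> A \<times> (verts H - A) = {}" using closed A by blast
      thus ?thesis using step r(1) A by blast
    qed
    thus "C \<in> comps (arcs_ends H) (verts H)"
      using sub closed r by (auto simp: comps_def cut_connected_def)
  next
    fix C assume "C \<in> comps (arcs_ends H) (verts H)"
    hence C: "C \<subseteq> verts H" "cut_connected (arcs_ends H) C" "arcs_ends H \<inter> C \<times> (verts H - C) = {}"
      by (auto simp: comps_def)
    \<comment> \<open>The vertices of \<open>C\<close> reachable from \<open>u\<close> have no arc
      to the rest of \<open>C\<close>, hence exhaust it.\<close>
    have "{v \<in> C. u \<rightarrow>\<^sup>*\<^bsub>H\<^esub> v} = C" if "u \<in> C" for u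
      using that C(1) by (intro cut_connectedD[OF C(2)]) (auto intro: reachable_adj_trans)
    thus "C \<in> sccs_verts" using C step[OF _ _ C(3)] 
      by (auto simp: sccs_verts_def cut_connected_def)
  qed
qed

text \<open>Used with \<open>P\<close> the nonempty subsets of one child's vertex set and
  \<open>Z\<close> the tubes outside that child.\<close>

lemma symdiff_Un:
  "Z \<inter> P = {} \<Longrightarrow> X \<subseteq> P \<Longrightarrow> Y \<subseteq> P \<Longrightarrow>
    ((Z \<union> X) - (Z \<union> Y)) \<union> ((Z \<union> Y) - (Z \<union> X)) = (X - Y) \<union> (Y - X)"
  by blast

lemma symdiff_insert:
  "X \<notin> Z \<Longrightarrow> Y \<notin> Z \<Longrightarrow> W \<noteq> X \<Longrightarrow> W \<noteq> Y \<Longrightarrow> X \<noteq> Y \<Longrightarrow>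
    (insert W (insert X Z) - insert W (insert Y Z)) \<union> (insert W (insert Y Z) - insert W (insert X Z)) = {X, Y}"
  by auto

section \<open>Search trees on induced subgraphs, indexed by vertex sets\<close>

context pair_graph
begin

abbreviation st :: "'a set \<Rightarrow> 'a rtree \<Rightarrow> bool" where
  "st W \<equiv> search_tree (with_proj G \<restriction> W)"

abbreviation CC :: "'a set \<Rightarrow> 'a set set" where
  "CC \<equiv> comps (parcs G)"

lemma sym_parcs: "sym (parcs G)"
  using arcs_symmetric by (auto intro: symI)

lemma sym_digraph_induce: "W \<subseteq> pverts G \<Longrightarrow> sym_digraph (with_proj G \<restriction> W)"
  by (rule induced_graph_imp_graph) (simp add: induced_induce)

lemma sccs_verts_induce:
  assumes "W \<subseteq> pverts G"
  shows "pre_digraph.sccs_verts (with_proj G \<restriction> W) = CC W"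
proof -
  have "arcs_ends (with_proj G \<restriction> W) = parcs G \<inter> W \<times> W"
    by (auto simp: arcs_ends_conv)
  hence "comps (arcs_ends (with_proj G \<restriction> W)) W = CC W"
    by (simp add: comps_restrict)
  thus ?thesis
    using sccs_verts_symmetric[OF sym_digraph_induce[OF assms]] by simp
qed

lemma sccs_induce:
  assumes "W \<subseteq> pverts G"
  shows "pre_digraph.sccs (with_proj G \<restriction> W) = (\<lambda>C. with_proj G \<restriction> C) ` CC W"
proof -
  interpret W: sym_digraph "with_proj G \<restriction> W"
    using assms by (rule sym_digraph_induce)
  have "W.sccs = induce_subgraph (with_proj G \<restriction> W) ` CC W"
    using W.sccs_conv_sccs_verts sccs_verts_induce[OF assms] by simp
  also have "\<dots> = (\<lambda>C. with_proj G \<restriction> C) ` CC W"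
    by (intro image_cong) (auto simp: induce_subgraph_def comps_def)
  finally show ?thesis .
qed

text \<open>That every vertex lies in some component is taken from reachability: \<open>x\<close>
  belongs to its strong component \<open>scc_of x\<close>.\<close>

lemma Union_CC:
  assumes "W \<subseteq> pverts G"
  shows "\<Union>(CC W) = W"
proof -
  interpret W: sym_digraph "with_proj G \<restriction> W"
    using assms by (rule sym_digraph_induce)
  have "W \<subseteq> \<Union>W.sccs_verts"
  proof
    fix x assume "x \<in> W"
    hence "x \<in> verts (with_proj G \<restriction> W)" by simp
    thus "x \<in> \<Union>W.sccs_verts" by (metis UnionI W.scc_of_in_sccs_verts W.in_scc_of_self)
  qed
  thus ?thesis using sccs_verts_induce[OF assms] by (auto simp: comps_def)
qed

lemma finite_subset_pverts: "W \<subseteq> pverts G \<Longrightarrow> finite W"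
  using pair_finite_verts finite_subset by blast

lemma finite_CC: "W \<subseteq> pverts G \<Longrightarrow> finite (CC W)"
  by (rule finite_subset[of _ "Pow W"]) (auto simp: comps_def finite_subset_pverts)

text \<open>Each component is the subgraph induced by its vertex set, so the selector of children
  can take vertex sets instead of digraphs as arguments.\<close>

lemma st_iff:
  assumes "W \<subseteq> pverts G"
  shows "st W T \<longleftrightarrow> (\<exists>r t. r \<in> W \<and> (\<forall>C \<in> CC (W - {r}). st C (t C)) \<and> T = node r (CC (W - {r})) t)"
proof -
  let ?I = "\<lambda>C. with_proj G \<restriction> C"
  have del: "pre_digraph.del_vert (?I W) r = ?I (W - {r})" for r
    by (auto simp: pre_digraph.del_vert_def induce_subgraph_def)
  have sccs: "pre_digraph.sccs (pre_digraph.del_vert (?I W) r) = ?I ` CC (W - {r})" for r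
    using assms by (subst del, intro sccs_induce) auto
  have fin: "finite (CC (W - {r}))" for r
    using assms by (intro finite_CC) auto
  show ?thesis
  proof
    assume "st W T"
    then obtain r ts t where T: "T = RNode r ts" "r \<in> W" "\<forall>C \<in> CC (W - {r}). st C (t (?I C))"
      "fset ts = (\<lambda>C. t (?I C)) ` CC (W - {r})"
      by (cases rule: search_tree.cases) (auto simp: sccs image_image)
    have "ts = Abs_fset ((\<lambda>C. t (?I C)) ` CC (W - {r}))"
      using T(4) by (metis fset_inverse)
    thus "\<exists>r t. r \<in> W \<and> (\<forall>C \<in> CC (W - {r}). st C (t C)) \<and> T = node r (CC (W - {r})) t"
      using T unfolding node_def by (intro exI[of _ r] exI[of _ "\<lambda>C. t (?I C)"]) simp
  next
    assume "\<exists>r t. r \<in> W \<and> (\<forall>C \<in> CC (W - {r}). st C (t C)) \<and> T = node r (CC (W - {r})) t"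
    then obtain r t where T: "r \<in> W" "\<forall>C \<in> CC (W - {r}). st C (t C)" "T = node r (CC (W - {r})) t"
      by blast
    show "st W T" unfolding T(3) node_def
      \<comment> \<open>The definition selects children by digraph; \<open>verts\<close> recovers
        the vertex set that indexes \<open>t\<close>.\<close>
      by (rule search_tree.intros[where t = "\<lambda>H. t (verts H)"])
        (use T fin in \<open>auto simp: sccs Abs_fset_inverse image_image\<close>)
  qed
qed

lemma st_node:
  "W \<subseteq> pverts G \<Longrightarrow> r \<in> W \<Longrightarrow> K = CC (W - {r}) \<Longrightarrow> (\<And>C. C \<in> K \<Longrightarrow> st C (t C)) \<Longrightarrow> st W (node r K t)"
  by (subst st_iff) (auto intro!: exI[of _ r] exI[of _ t])

lemma st_rootD:
  assumes "W \<subseteq> pverts G" "st W T" "rt_root T = r"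
  shows "\<exists>t. (\<forall>C \<in> CC (W - {r}). st C (t C)) \<and> T = node r (CC (W - {r})) t"
proof -
  obtain q t where "\<forall>C \<in> CC (W - {q}). st C (t C)" "T = node q (CC (W - {q})) t"
    using assms(1,2) st_iff by blast
  thus ?thesis using assms(3) by auto
qed

lemma rt_verts_st: "W \<subseteq> pverts G \<Longrightarrow> st W T \<Longrightarrow> rt_verts T = W"
  using search_tree_verts[of "with_proj G \<restriction> W" T] wellformed_induce_subgraph by simp

lemma tubes_st_subset: "W \<subseteq> pverts G \<Longrightarrow> st W T \<Longrightarrow> tubes T \<subseteq> Pow W - {{}}"
  using tubes_subset[of _ T] rt_verts_st by auto

lemma tubes_st_node:
  assumes "W \<subseteq> pverts G" "st W (node r K t)" "finite K"
  shows "tubes (node r K t) = insert W (\<Union>C \<in> K. tubes (t C))"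
  using tubes_node[OF assms(3)] rt_verts_st[OF assms(1,2)] by simp

section \<open>Rotation sequences and their lifting to larger trees\<close>

text \<open>For \<open>W = pverts G\<close> this is the arc relation of the rotation graph.\<close>

definition rot :: "'a set \<Rightarrow> 'a rtree \<Rightarrow> 'a rtree \<Rightarrow> bool" where
  "rot W S T \<longleftrightarrow> st W S \<and> st W T \<and> rotation S T"

text \<open>An upper bound instead of an exact length, so that the budgets of successive phases
  simply add up.\<close>

definition steps :: "'a set \<Rightarrow> nat \<Rightarrow> 'a rtree \<Rightarrow> 'a rtree \<Rightarrow> bool" where
  "steps W n S T \<longleftrightarrow> (\<exists>k\<le>n. (rot W ^^ k) S T)"

lemma steps_refl: "steps W n S S"
  unfolding steps_def by (intro exI[of _ 0]) auto

lemma steps_rot: "rot W S T \<Longrightarrow> steps W 1 S T"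
  unfolding steps_def by (intro exI[of _ 1]) auto

lemma steps_trans: "steps W m R S \<Longrightarrow> steps W n S T \<Longrightarrow> steps W (m + n) R T"
  unfolding steps_def by (metis add_mono relpowp_trans)

lemma steps_mono: "steps W m S T \<Longrightarrow> m \<le> n \<Longrightarrow> steps W n S T"
  unfolding steps_def by (meson order_trans)

text \<open>Allows the sequence that raises \<open>u\<close> in the target tree to be run
  backwards.\<close>

lemma steps_sym:
  assumes "steps W n S T"
  shows "steps W n T S"
proof -
  have "(rot W ^^ k) T S" if "(rot W ^^ k) S T" for k
    using that
  proof (induction k arbitrary: T)
    case (Suc k)
    then obtain U where "(rot W ^^ k) S U" "rot W U T" by auto
    thus ?case using Suc.IH by (metis relpowp_Suc_I2 rot_def rotation_commute)
  qed auto
  thus ?thesis using assms unfolding steps_def by blast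
qed

text \<open>All tubes of the child on \<open>C\<close> are nonempty subsets of \<open>C\<close>, and
  no other tube of the tree is. Hence replacing that child changes the tubes exactly as the inner
  rotation does.\<close>

lemma rot_node_child:
  assumes "W \<subseteq> pverts G" "r \<in> W" "K = CC (W - {r})" "C \<in> K" "\<And>D. D \<in> K \<Longrightarrow> st D (t D)"
    and "rot C (t C) Y"
  shows "rot W (node r K t) (node r K (t(C := Y)))"
proof -
  \<comment> \<open>\<open>?Z\<close> collects the tubes common to both trees: \<open>W\<close> and
    those of the other children.\<close>
  let ?t = "t(C := Y)" and ?Z = "insert W (\<Union>D \<in> K - {C}. tubes (t D))"
  have sub: "D \<subseteq> W - {r}" if "D \<in> K" for D using that assms(3) by (auto simp: comps_def)
  have t: "st D (?t D)" if "D \<in> K" for D using assms that by (auto simp: rot_def)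
  have fin: "finite K" using assms(1,3) by (auto intro: finite_CC)
  have S: "st W (node r K t)" using assms(1-3,5) by (rule st_node)
  have T: "st W (node r K ?t)" by (rule st_node[OF assms(1-3), of ?t, OF t])
  have tS: "tubes (node r K t) = ?Z \<union> tubes (t C)"
    using tubes_st_node[OF assms(1) S fin] \<open>C \<in> K\<close> by auto
  have tT: "tubes (node r K ?t) = ?Z \<union> tubes Y"
  proof -
    have "(\<Union>D \<in> K. tubes (?t D)) = tubes Y \<union> (\<Union>D \<in> K - {C}. tubes (t D))"
      using \<open>C \<in> K\<close> by (auto split: if_splits)
    thus ?thesis using tubes_st_node[OF assms(1) T fin] by (simp add: Un_commute)
  qed
  have "?Z \<inter> (Pow C - {{}}) = {}"
  proof -
    have "tubes (t D) \<inter> (Pow C - {{}}) = {}" if "D \<in> K - {C}" for D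
    proof -
      have "D \<inter> C = {}" using comps_disjoint[of D _ _ C] that assms(3,4) by auto
      moreover have "tubes (t D) \<subseteq> Pow D - {{}}"
        using that sub assms(1,5) by (intro tubes_st_subset) auto
      ultimately show ?thesis by blast
    qed
    moreover have "W \<notin> Pow C" using sub[OF \<open>C \<in> K\<close>] assms(2) by auto
    ultimately show ?thesis by blast
  qed
  moreover have "tubes (t C) \<subseteq> Pow C - {{}}" "tubes Y \<subseteq> Pow C - {{}}"
    using assms(1,6) sub[OF \<open>C \<in> K\<close>]
    by (intro tubes_st_subset; auto simp: rot_def)+
  ultimately have
    "(tubes (node r K t) - tubes (node r K ?t)) \<union> (tubes (node r K ?t) - tubes (node r K t)) =
     (tubes (t C) - tubes Y) \<union> (tubes Y - tubes (t C))"
    unfolding tS tT by (rule symdiff_Un)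
  thus ?thesis using S T assms(6) by (simp add: rot_def rotation_def)
qed

lemma steps_node_child:
  assumes "W \<subseteq> pverts G" "r \<in> W" "K = CC (W - {r})" "C \<in> K" "\<And>D. D \<in> K \<Longrightarrow> st D (t D)"
    and "steps C n (t C) Y"
  shows "steps W n (node r K t) (node r K (t(C := Y)))"
proof -
  have "(rot W ^^ k) (node r K t) (node r K (t(C := Y)))" if "(rot C ^^ k) (t C) Y" for k
    using that
  proof (induction k arbitrary: Y)
    case (Suc k)
    then obtain X where X: "(rot C ^^ k) (t C) X" "rot C X Y" by auto
    have st: "st D ((t(C := X)) D)" if "D \<in> K" for D
      using assms(5)[OF that] X(2) by (simp add: rot_def)
    have "rot C ((t(C := X)) C) Y" using X(2) by simp
    \<comment> \<open>The last rotation starts from the already updated selection;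
      \<open>fun_upd_upd\<close> merges the two updates at \<open>C\<close>.\<close>
    from rot_node_child[OF assms(1-4) st this]
    have "rot W (node r K (t(C := X))) (node r K (t(C := Y)))" by (simp only: fun_upd_upd)
    with Suc.IH[OF X(1)] show ?case by (rule relpowp_Suc_I)
  qed simp
  thus ?thesis using assms(6) unfolding steps_def by blast
qed

text \<open>The children are transformed one after another, and the costs add because each rotation
  touches a single child.\<close>

lemma steps_node:
  assumes "W \<subseteq> pverts G" "r \<in> W" "K = CC (W - {r})"
    and "\<And>D. D \<in> K \<Longrightarrow> st D (t D)" "\<And>D. D \<in> K \<Longrightarrow> st D (t' D)"
    and "\<And>D. D \<in> K \<Longrightarrow> steps D (f D) (t D) (t' D)"
  shows "steps W (\<Sum>D\<in>K. f D) (node r K t) (node r K t')"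
proof -
  \<comment> \<open>The intermediate selection, with the children in \<open>F\<close> already
    replaced.\<close>
  let ?m = "\<lambda>F D. if D \<in> F then t' D else t D"
  have "steps W (\<Sum>D\<in>F. f D) (node r K t) (node r K (?m F))" if "finite F" "F \<subseteq> K" for F
    using that
  proof (induction F rule: finite_induct)
    case (insert C F)
    have C: "C \<in> K" using insert.prems by simp
    have st: "st D (?m F D)" if "D \<in> K" for D using assms(4,5) that by simp
    have "steps C (f C) (?m F C) (t' C)" using assms(6)[OF C] insert.hyps(2) by simp
    from steps_node_child[OF assms(1-3) C st this]
    have "steps W (f C) (node r K (?m F)) (node r K ((?m F)(C := t' C)))" by simp
    moreover have "(?m F)(C := t' C) = ?m (insert C F)" by auto
    ultimately have "steps W (f C) (node r K (?m F)) (node r K (?m (insert C F)))" by simp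
    moreover have "steps W (\<Sum>D\<in>F. f D) (node r K t) (node r K (?m F))"
      using insert.IH insert.prems by simp
    ultimately have "steps W ((\<Sum>D\<in>F. f D) + f C) (node r K t) (node r K (?m (insert C F)))"
      by (rule steps_trans[rotated])
    thus ?case using insert.hyps by (simp add: add.commute)
  qed (simp add: steps_refl)
  moreover have "finite K" using assms(1,3) by (auto intro: finite_CC)
  ultimately have "steps W (\<Sum>D\<in>K. f D) (node r K t) (node r K (?m K))" by blast
  moreover have "node r K (?m K) = node r K t'" by (rule node_cong) auto
  ultimately show ?thesis by simp
qed

section \<open>Raising a universal vertex to the root\<close>

text \<open>Exchanging \<open>r\<close> with its only child \<open>u\<close> puts \<open>r\<close>
  at the root of the component \<open>A\<close> of \<open>W - {u}\<close> that contains it. The tube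
  \<open>W - {r}\<close> is replaced by \<open>A\<close>, and all others are kept.\<close>

lemma rot_swap_universal:
  assumes W: "W \<subseteq> pverts G" and ru: "r \<in> W" "u \<in> W" "r \<noteq> u"
    and univ: "\<And>x. x \<in> W \<Longrightarrow> x \<noteq> u \<Longrightarrow> (u, x) \<in> parcs G"
    and t: "\<And>C. C \<in> CC (W - {r} - {u}) \<Longrightarrow> st C (t C)"
  shows "\<exists>t'. rot W (node r {W - {r}} (\<lambda>_. node u (CC (W - {r} - {u})) t)) (node u (CC (W - {u})) t')"
proof -
  let ?K = "CC (W - {r} - {u})"
  let ?S = "node u ?K t" and ?O = "\<Union>C \<in> ?K. tubes (t C)"
  obtain A where A: "A \<in> CC (W - {u})" "r \<in> A"
    using Union_CC[of "W - {u}"] W ru by blast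
  have AW: "A \<subseteq> W - {u}" using A by (auto simp: comps_def)
  \<comment> \<open>The old grandchildren are the components of \<open>W - {u}\<close> other than
    \<open>A\<close>, which stay below \<open>u\<close>, together with those of
    \<open>A - {r}\<close>, which go below \<open>r\<close>. Hence \<open>t\<close> serves at both
    places.\<close>
  have K: "?K = (CC (W - {u}) - {A}) \<union> CC (A - {r})"
    using comps_Diff_singleton[OF sym_parcs A] by (simp add: Diff_insert2[symmetric] insert_commute)
  let ?B = "node r (CC (A - {r})) t"
  let ?t' = "\<lambda>C. if C = A then ?B else t C"
  let ?T = "node u (CC (W - {u})) ?t'"
  have fin: "finite ?K" "finite (CC (W - {u}))" "finite (CC (A - {r}))"
    using W AW by (auto intro!: finite_CC)
  have S: "st (W - {r}) ?S" by (rule st_node) (use W ru t in auto)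
  have conn: "CC (W - {r}) = {W - {r}}"
    by (intro comps_cut_connected cut_connected_universal[of _ u] sym_parcs) (use ru univ in auto)
  have RS: "st W (node r {W - {r}} (\<lambda>_. ?S))"
    by (rule st_node) (use W ru S conn in auto)
  have B: "st A ?B" by (rule st_node) (use W AW A t K in auto)
  have T: "st W ?T" by (rule st_node) (use W ru B t K in auto)
  have "tubes ?S = insert (W - {r}) ?O"
    using W by (intro tubes_st_node[OF _ S fin(1)]) auto
  hence tS: "tubes (node r {W - {r}} (\<lambda>_. ?S)) = insert W (insert (W - {r}) ?O)"
    using tubes_st_node[OF W RS] by simp
  have tB: "tubes ?B = insert A (\<Union>C \<in> CC (A - {r}). tubes (t C))"
    using W AW by (intro tubes_st_node[OF _ B fin(3)]) auto
  have tT: "tubes ?T = insert W (insert A ?O)"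
  proof -
    have "(\<Union>C \<in> CC (W - {u}). tubes (?t' C)) = tubes ?B \<union> (\<Union>C \<in> CC (W - {u}) - {A}. tubes (t C))"
      using A(1) by (auto split: if_splits)
    also have "\<dots> = insert A ?O"
      unfolding tB K by blast
    finally show ?thesis using tubes_st_node[OF W T fin(2)] by simp
  qed
  \<comment> \<open>The kept tubes below avoid both \<open>r\<close> and \<open>u\<close>, whereas
    \<open>W - {r}\<close> contains \<open>u\<close> and \<open>A\<close> contains
    \<open>r\<close>.\<close>
  have "X \<subseteq> W - {r} - {u}" if "X \<in> ?O" for X
  proof -
    from that obtain C where C: "C \<in> ?K" "X \<in> tubes (t C)" by blast
    hence "C \<subseteq> W - {r} - {u}" by (auto simp: comps_def)
    thus ?thesis using tubes_st_subset[OF _ t[OF C(1)]] C(2) W by blast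
  qed
  hence "W - {r} \<notin> ?O" "A \<notin> ?O" using ru A(2) by blast+
  moreover have "W \<noteq> W - {r}" "W \<noteq> A" "A \<noteq> W - {r}" using ru A AW by blast+
  ultimately have "(tubes (node r {W - {r}} (\<lambda>_. ?S)) - tubes ?T) \<union>
      (tubes ?T - tubes (node r {W - {r}} (\<lambda>_. ?S))) = {W - {r}, A}"
    unfolding tS tT by (intro symdiff_insert) auto
  hence "rotation (node r {W - {r}} (\<lambda>_. ?S)) ?T"
    using \<open>A \<noteq> W - {r}\<close> by (simp add: rotation_def)
  thus ?thesis using RS T unfolding rot_def by blast
qed

text \<open>If the root \<open>r\<close> is not \<open>u\<close>, then \<open>u\<close> keeps
  \<open>W - {r}\<close> connected, so the root has a single child. Raise \<open>u\<close> to the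
  top of that child by induction, then swap it with \<open>r\<close>.\<close>

lemma raise_universal:
  assumes "W \<subseteq> pverts G" "u \<in> W" "\<And>x. x \<in> W \<Longrightarrow> x \<noteq> u \<Longrightarrow> (u, x) \<in> parcs G" "st W T"
  shows "\<exists>T'. steps W (card W - 1) T T' \<and> st W T' \<and> rt_root T' = u"
  using assms
proof (induction "card W" arbitrary: W T)
  case 0
  thus ?case using finite_subset_pverts by auto
next
  case (Suc n W T)
  note W = Suc.prems(1)
  obtain r t where T: "r \<in> W" "\<And>C. C \<in> CC (W - {r}) \<Longrightarrow> st C (t C)" "T = node r (CC (W - {r})) t"
    using st_iff[OF W] Suc.prems(4) by blast
  show ?case
  proof (cases "r = u")
    case True
    hence "rt_root T = u" using T(3) by simp
    thus ?thesis using Suc.prems(4) steps_refl by blast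
  next
    case False
    let ?V = "W - {r}"
    have V: "?V \<subseteq> pverts G" "u \<in> ?V" using W Suc.prems(2) False by auto
    have conn: "CC ?V = {?V}"
      by (intro comps_cut_connected cut_connected_universal[of _ u] sym_parcs)
        (use V Suc.prems(3) in auto)
    have fin: "finite W" using W by (rule finite_subset_pverts)
    have card: "card ?V = n" using Suc.hyps(2) T(1) fin by simp
    \<comment> \<open>Subtraction truncates at zero: \<open>n - 1\<close> rotations in the child and
      one swap add up to \<open>card W - 1 = n\<close> only for positive \<open>n\<close>.\<close>
    have "n > 0" using card V(2) fin by (metis card_gt_0_iff empty_iff finite_Diff)
    have "\<exists>T'. steps ?V (card ?V - 1) (t ?V) T' \<and> st ?V T' \<and> rt_root T' = u"
      using Suc.prems(3) T(2) conn by (intro Suc.hyps(1) card[symmetric] V) auto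
    then obtain T' where T': "steps ?V (n - 1) (t ?V) T'" "st ?V T'" "rt_root T' = u"
      using card by auto
    obtain s where s: "\<forall>C \<in> CC (?V - {u}). st C (s C)" "T' = node u (CC (?V - {u})) s"
      using st_rootD[OF V(1) T'(2,3)] by blast
    have "steps W (n - 1) T (node r {?V} (t(?V := T')))"
      unfolding T(3) conn by (rule steps_node_child) (use W T T' conn in auto)
    \<comment> \<open>Both selections agree on the only child; the constant one is the form in
      \<open>rot_swap_universal\<close>.\<close>
    moreover have "node r {?V} (t(?V := T')) = node r {?V} (\<lambda>_. T')"
      by (rule node_cong) auto
    moreover obtain t' where t': "rot W (node r {?V} (\<lambda>_. T')) (node u (CC (W - {u})) t')"
      using rot_swap_universal[OF W T(1) Suc.prems(2) False Suc.prems(3) s(1)[rule_format]] s(2) by auto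
    ultimately have "steps W (n - 1 + 1) T (node u (CC (W - {u})) t')"
      using steps_trans steps_rot by metis
    moreover have "n - 1 + 1 = card W - 1" using \<open>n > 0\<close> Suc.hyps(2) by simp
    ultimately show ?thesis using t' by (metis rot_def rt_root_node)
  qed
qed

section \<open>Arc count and recursion on the components\<close>

text \<open>Arcs count every edge twice, so this is the factor two in the diameter bound.\<close>

lemma sum_arcs_le:
  assumes "W \<subseteq> pverts G" "u \<in> W" "\<And>x. x \<in> W \<Longrightarrow> x \<noteq> u \<Longrightarrow> (u, x) \<in> parcs G"
  shows "2 * (card W - 1) + (\<Sum>C \<in> CC (W - {u}). card (parcs G \<inter> C \<times> C)) \<le> card (parcs G \<inter> W \<times> W)"
proof -
  \<comment> \<open>\<open>?A\<close> and \<open>?B\<close> are the arcs out of and into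
    \<open>u\<close>, each \<open>card W - 1\<close> in number; \<open>?U\<close> consists of the
    arcs inside the components.\<close>
  let ?A = "{u} \<times> (W - {u})" and ?B = "(W - {u}) \<times> {u}"
  let ?U = "\<Union>C \<in> CC (W - {u}). parcs G \<inter> C \<times> C"
  have fin: "finite W" "finite (CC (W - {u}))"
    using assms(1) by (auto intro!: finite_CC finite_subset_pverts)
  have sub: "C \<subseteq> W - {u}" if "C \<in> CC (W - {u})" for C using that by (auto simp: comps_def)
  have U: "?U \<subseteq> (W - {u}) \<times> (W - {u})" using sub by blast
  have "(\<Sum>C \<in> CC (W - {u}). card (parcs G \<inter> C \<times> C)) = card ?U"
  proof (rule card_UN_disjoint[symmetric])
    show "\<forall>C\<in>CC (W - {u}). finite (parcs G \<inter> C \<times> C)" by simp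
    show "\<forall>C\<in>CC (W - {u}). \<forall>D\<in>CC (W - {u}). C \<noteq> D \<longrightarrow>
        (parcs G \<inter> C \<times> C) \<inter> (parcs G \<inter> D \<times> D) = {}"
      using comps_disjoint by fastforce
  qed (rule fin)
  moreover have "card ((?A \<union> ?B) \<union> ?U) = card ?A + card ?B + card ?U"
  proof -
    have "finite ?U" using fin U by (auto intro: finite_subset)
    moreover have "finite ?A" "finite ?B" using fin by auto
    moreover have "?A \<inter> ?B = {}" "(?A \<union> ?B) \<inter> ?U = {}" using U by auto
    ultimately show ?thesis by (simp add: card_Un_disjoint)
  qed
  moreover have "?A \<union> ?B \<union> ?U \<subseteq> parcs G \<inter> W \<times> W"
  proof -
    have "?A \<subseteq> parcs G" using assms(3) by auto
    moreover have "?B \<subseteq> parcs G" using assms(3) symD[OF sym_parcs] by blast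
    ultimately show ?thesis using assms(2) sub by blast
  qed
  hence "card ((?A \<union> ?B) \<union> ?U) \<le> card (parcs G \<inter> W \<times> W)"
    by (intro card_mono) auto
  moreover have "card ?A = card W - 1" "card ?B = card W - 1"
    using fin assms(2) by (simp_all add: card_cartesian_product)
  ultimately show ?thesis by linarith
qed

text \<open>Trivial perfectness enters only through \<open>univ\<close>, which ranges over all
  cut-connected subsets so that it passes to the components of \<open>W - {u}\<close>.\<close>

lemma steps_search_trees:
  assumes "W \<subseteq> pverts G" "cut_connected (parcs G) W" "st W S" "st W T"
    and univ: "\<And>C. C \<subseteq> W \<Longrightarrow> cut_connected (parcs G) C \<Longrightarrow>
      \<exists>u \<in> C. \<forall>x \<in> C. x \<noteq> u \<longrightarrow> (u, x) \<in> parcs G"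
  shows "steps W (card (parcs G \<inter> W \<times> W)) S T"
  using assms
proof (induction "card W" arbitrary: W S T rule: less_induct)
  case (less W S T)
  note W = less.prems(1)
  obtain u where u: "u \<in> W" "\<And>x. x \<in> W \<Longrightarrow> x \<noteq> u \<Longrightarrow> (u, x) \<in> parcs G"
    using less.prems(5)[OF order_refl less.prems(2)] by blast
  let ?K = "CC (W - {u})" and ?f = "\<lambda>C. card (parcs G \<inter> C \<times> C)"
  have sub: "C \<subseteq> W - {u}" "cut_connected (parcs G) C" if "C \<in> ?K" for C
    using that by (auto simp: comps_def)
  obtain S' where S': "steps W (card W - 1) S S'" "st W S'" "rt_root S' = u"
    using raise_universal[OF W u less.prems(3)] by blast
  obtain T' where T': "steps W (card W - 1) T T'" "st W T'" "rt_root T' = u"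
    using raise_universal[OF W u less.prems(4)] by blast
  obtain s where s: "\<forall>C \<in> ?K. st C (s C)" "S' = node u ?K s"
    using st_rootD[OF W S'(2,3)] by blast
  obtain t where t: "\<forall>C \<in> ?K. st C (t C)" "T' = node u ?K t"
    using st_rootD[OF W T'(2,3)] by blast
  have "steps W (\<Sum>C \<in> ?K. ?f C) S' T'"
    unfolding s(2) t(2)
  proof (rule steps_node[OF W u(1) refl s(1)[rule_format] t(1)[rule_format]])
    fix C assume C: "C \<in> ?K"
    show "steps C (?f C) (s C) (t C)"
    proof (rule less.hyps)
      show "card C < card W"
        using sub[OF C] u(1) finite_subset_pverts[OF W] by (auto intro!: psubset_card_mono)
      show "\<exists>u \<in> D. \<forall>x \<in> D. x \<noteq> u \<longrightarrow> (u, x) \<in> parcs G"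
        if "D \<subseteq> C" "cut_connected (parcs G) D" for D
        using that sub[OF C] by (intro less.prems(5)) auto
    qed (use W sub[OF C] s(1) t(1) C in auto)
  qed
  \<comment> \<open>Raise \<open>u\<close> in \<open>S\<close>, transform the children, then undo
    the raising of \<open>u\<close> in \<open>T\<close>.\<close>
  hence "steps W ((card W - 1) + (\<Sum>C \<in> ?K. ?f C) + (card W - 1)) S T"
    using steps_trans S'(1) steps_sym[OF T'(1)] by blast
  thus ?case by (rule steps_mono) (use sum_arcs_le[OF W u] in auto)
qed

end

section \<open>Universal vertices in trivially perfect graphs\<close>

text \<open>A dominating vertex in \<open>C\<close> is itself universal; otherwise \<open>C\<close>
  is a cut-connected set of a smaller graph with the same arcs inside \<open>C\<close>.\<close>

lemma trivially_perfect_universal: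
  assumes "trivially_perfect G" "C \<subseteq> pverts G" "cut_connected (parcs G) C"
  shows "\<exists>u \<in> C. \<forall>x \<in> C. x \<noteq> u \<longrightarrow> (u, x) \<in> parcs G"
  using assms
proof (induction arbitrary: C rule: trivially_perfect.induct)
  case (single v)
  thus ?case by (auto simp: cut_connected_def)
next
  case (dominating G v)
  show ?case
  proof (cases "v \<in> C")
    case True
    thus ?thesis using dominating.prems by auto
  next
    case False
    have "(parcs G \<union> {v} \<times> pverts G \<union> pverts G \<times> {v}) \<inter> C \<times> C = parcs G \<inter> C \<times> C"
      using False by auto
    note cong = cut_connected_cong[OF this]
    have "cut_connected (parcs G \<union> {v} \<times> pverts G \<union> pverts G \<times> {v}) C"
      using dominating.prems(2) by simp
    hence "cut_connected (parcs G) C" by (simp only: cong)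
    moreover have "C \<subseteq> pverts G" using dominating.prems(1) False by auto
    ultimately obtain u where u: "u \<in> C" "\<forall>x \<in> C. x \<noteq> u \<longrightarrow> (u, x) \<in> parcs G"
      using dominating.IH by blast
    show ?thesis by (rule bexI[of _ u]) (use u in simp_all)
  qed
next
  case (disjoint_union G H)
  interpret G: pair_graph G by (rule trivially_perfect_pair_graph) fact
  interpret H: pair_graph H by (rule trivially_perfect_pair_graph) fact
  have arcs: "parcs G \<subseteq> pverts G \<times> pverts G" "parcs H \<subseteq> pverts H \<times> pverts H"
    using G.in_arcsD1 G.in_arcsD2 H.in_arcsD1 H.in_arcsD2 by auto
  have C: "C \<subseteq> pverts G \<union> pverts H" "cut_connected (parcs G \<union> parcs H) C"
    using disjoint_union.prems by auto
  have "C = C \<inter> pverts G \<union> C \<inter> pverts H" using C(1) by blast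
  \<comment> \<open>Regarding \<open>C\<close> as its own component lets \<open>in_comps_Un\<close>
    place it on one side of the union.\<close>
  moreover have "C \<in> comps (parcs G \<union> parcs H) C" using C(2) by (simp add: comps_def)
  ultimately have "C \<in> comps (parcs G \<union> parcs H) (C \<inter> pverts G) \<union>
      comps (parcs G \<union> parcs H) (C \<inter> pverts H)"
    using arcs disjoint_union.hyps(3) by (intro in_comps_Un) auto
  hence "C \<subseteq> pverts G \<or> C \<subseteq> pverts H" by (auto simp: comps_def)
  thus ?case
  proof
    assume CG: "C \<subseteq> pverts G"
    have "(parcs G \<union> parcs H) \<inter> C \<times> C = parcs G \<inter> C \<times> C"
      using CG arcs(2) disjoint_union.hyps(3) by blast
    from cut_connected_cong[OF this] C(2) have "cut_connected (parcs G) C" by (simp only:)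
    then obtain u where u: "u \<in> C" "\<forall>x \<in> C. x \<noteq> u \<longrightarrow> (u, x) \<in> parcs G"
      using disjoint_union.IH(1) CG by blast
    show ?thesis by (rule bexI[of _ u]) (use u in simp_all)
  next
    assume CH: "C \<subseteq> pverts H"
    have "(parcs G \<union> parcs H) \<inter> C \<times> C = parcs H \<inter> C \<times> C"
      using CH arcs(1) disjoint_union.hyps(3) by blast
    from cut_connected_cong[OF this] C(2) have "cut_connected (parcs H) C" by (simp only:)
    then obtain u where u: "u \<in> C" "\<forall>x \<in> C. x \<noteq> u \<longrightarrow> (u, x) \<in> parcs H"
      using disjoint_union.IH(2) CH by blast
    show ?thesis by (rule bexI[of _ u]) (use u in simp_all)
  qed
qed

section \<open>From rotation sequences to the diameter\<close>

text \<open>Each edge is the image of its two orientations, which differ because there are no loops;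
  the sum over these fibres counts all arcs.\<close>

lemma card_parcs_eq:
  assumes "pair_graph G"
  shows "card (parcs G) = 2 * card (edges G)"
proof -
  interpret pair_graph G by fact
  let ?f = "\<lambda>(u, v). {u, v}"
  have "card {a. a \<in> parcs G \<and> ?f a = e} = 2" if e: "e \<in> edges G" for e
  proof -
    obtain u v where uv: "(u, v) \<in> parcs G" "e = {u, v}" using e by (auto simp: edges_def)
    have "{a. a \<in> parcs G \<and> ?f a = e} = {(u, v), (v, u)}"
      using uv arcs_symmetric by (auto simp: doubleton_eq_iff)
    moreover have "u \<noteq> v" using uv(1) no_loops' by blast
    ultimately show ?thesis by simp
  qed
  hence "(\<Sum>e\<in>edges G. \<Sum>a | a \<in> parcs G \<and> ?f a = e. 1) = 2 * card (edges G)" by simp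
  moreover have "(\<Sum>e\<in>edges G. \<Sum>a | a \<in> parcs G \<and> ?f a = e. 1) = (\<Sum>a\<in>parcs G. 1::nat)"
    by (rule sum.group) (auto simp: edges_def)
  ultimately show ?thesis by simp
qed

text \<open>The relation power unfolds to a walk with \<open>k\<close> arcs, whose unit-weight cost
  is \<open>k\<close>. For \<open>k = 0\<close> the empty walk requires \<open>u\<close> to be a
  vertex.\<close>

lemma (in pair_wf_digraph) mu_le_relpowp:
  assumes "((\<lambda>x y. (x, y) \<in> parcs G) ^^ k) u v" "u \<in> pverts G"
  shows "\<mu> (\<lambda>_. 1) u v \<le> ereal (real k)"
proof -
  have "\<exists>p. awalk u p v \<and> length p = k"
    using assms
  proof (induction k arbitrary: u)
    case 0
    thus ?case by (auto simp: awalk_Nil_iff)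
  next
    case (Suc k)
    obtain w where w: "(u, w) \<in> parcs G" "((\<lambda>x y. (x, y) \<in> parcs G) ^^ k) w v"
      using relpowp_Suc_D2[OF Suc.prems(1)] by blast
    obtain p where "awalk w p v" "length p = k"
      using Suc.IH[OF w(2)] in_arcsD2[OF w(1)] by blast
    hence "awalk u ((u, w) # p) v" "length ((u, w) # p) = Suc k"
      using w(1) by (auto simp: awalk_Cons_iff)
    thus ?case by blast
  qed
  then obtain p where p: "awalk u p v" "length p = k" by blast
  have "awalk_cost (\<lambda>_. 1) p = length p" by (induction p) (auto simp: awalk_cost_def)
  thus ?thesis using min_cost_le_walk_cost[OF p(1), of "\<lambda>_. 1"] p(2) by simp
qed

theorem theorem11:
  fixes G :: "'a pair_pre_digraph" and m :: nat
  assumes "pair_graph G"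
    and "connected (with_proj G)"
    and "trivially_perfect G"
    and "card (edges G) = m"
  shows "associahedron_diameter (with_proj G) \<le> ereal (real (2 * m))"
proof -
  interpret pair_graph G by fact
  \<comment> \<open>Identifies \<open>st (pverts G)\<close> with the search trees of the whole
    graph.\<close>
  have G: "with_proj G \<restriction> pverts G = with_proj G"
    using in_arcsD1 in_arcsD2 by (auto simp: induce_subgraph_def with_proj_def)
  let ?R = "rotation_graph (with_proj G)"
  interpret R: pair_wf_digraph ?R by (rule pair_wf_digraph_rotation_graph)
  have "strongly_connected (with_proj G)"
    using assms(2) sym_arcs by (intro symmetric_connected_imp_strongly_connected)
  \<comment> \<open>A strongly connected graph is its own strong component, which translates into
    cut-connectedness of the vertex set.\<close>
  hence "pverts G \<in> sccs_verts"
    by (auto simp: strongly_connected_def sccs_verts_def dest: reachable_in_verts)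
  hence conn: "cut_connected (parcs G) (pverts G)"
    using sccs_verts_induce[OF order_refl] by (simp add: G comps_def)
  have card: "card (parcs G \<inter> pverts G \<times> pverts G) = 2 * m"
  proof -
    have "parcs G \<inter> pverts G \<times> pverts G = parcs G" using in_arcsD1 in_arcsD2 by auto
    thus ?thesis using card_parcs_eq[OF assms(1)] assms(4) by simp
  qed
  have rot: "rot (pverts G) = (\<lambda>S T. (S, T) \<in> parcs ?R)"
    by (intro ext) (simp add: rot_def rotation_graph_def G)
  have "R.\<mu> (\<lambda>_. 1) S T \<le> ereal (real (2 * m))" if "S \<in> pverts ?R" "T \<in> pverts ?R" for S T
  proof -
    have "steps (pverts G) (2 * m) S T"
      unfolding card[symmetric]
      by (rule steps_search_trees[OF order_refl conn])
        (use that trivially_perfect_universal[OF assms(3)] in \<open>auto simp: rotation_graph_def G\<close>)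
    then obtain k where k: "k \<le> 2 * m" "((\<lambda>S T. (S, T) \<in> parcs ?R) ^^ k) S T"
      unfolding steps_def rot by blast
    have "R.\<mu> (\<lambda>_. 1) S T \<le> ereal (real k)" using R.mu_le_relpowp[OF k(2) that(1)] .
    also have "\<dots> \<le> ereal (real (2 * m))" using k(1) by simp
    finally show ?thesis .
  qed
  thus ?thesis
    unfolding associahedron_diameter_def graph_diameter_def by (auto intro!: SUP_least)
qed

end
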